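(* For every positive integer $n$, $\hat{r}_c(nK_2,P_3)=\lfloor (5n-1)/2\rfloor$.
   Context: All graphs are finite and simple. $nK_2$ denotes a matching with $n$ edges, and $P_3$ denotes the path with 3 vertices (2 edges). For graphs $G, G_1, G_2$, write $G\to(G_1,G_2)$ if for every colouring of the edges of $G$ with red and blue, $G$ contains either a red copy of $G_1$ (all edges red) or a blue copy of $G_2$ (all edges blue). The connected size Ramsey number $\hat{r}_c(G_1,G_2)$ is the minimum number of edges of a connected graph $G$ with $G\to(G_1,G_2)$. *)

theory Defs
  imports Complex_Main "HOL-Library.Ramsey" "HOL-Library.Extended_Nat"
begin

datatype 'a graph = Graph (verts: "'a set") (edges: "'a set set")

definition simple_graph :: "'a graph \<Rightarrow> bool" where
  "simple_graph G \<longleftrightarrow> finite (verts G) \<and> edges G \<subseteq> [verts G]\<^bsup>2\<^esup>"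

definition connected_graph :: "'a graph \<Rightarrow> bool" where
  "connected_graph G \<longleftrightarrow> verts G \<noteq> {} \<and>
     (\<forall>u \<in> verts G. \<forall>v \<in> verts G. (u, v) \<in> {(x, y). {x, y} \<in> edges G}\<^sup>*)"

text \<open>Copies are subgraphs, not necessarily induced ones.\<close>

definition contains_copy :: "'a graph \<Rightarrow> 'b graph \<Rightarrow> bool" where
  "contains_copy G H \<longleftrightarrow>
     (\<exists>f. inj_on f (verts H) \<and> f ` verts H \<subseteq> verts G \<and> (\<forall>e \<in> edges H. f ` e \<in> edges G))"

datatype colour = Red | Blue

definition colour_subgraph :: "'a graph \<Rightarrow> ('a set \<Rightarrow> colour) \<Rightarrow> colour \<Rightarrow> 'a graph" where
  "colour_subgraph G c k = Graph (verts G) {e \<in> edges G. c e = k}"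

definition arrows :: "'a graph \<Rightarrow> 'b graph \<Rightarrow> 'c graph \<Rightarrow> bool" where
  "arrows G G1 G2 \<longleftrightarrow>
     (\<forall>c. contains_copy (colour_subgraph G c Red) G1 \<or>
          contains_copy (colour_subgraph G c Blue) G2)"

text \<open>
  Every finite graph is isomorphic to one with natural numbers as vertices, so it is enough
  to let \<open>G\<close> range over \<open>nat graph\<close>. The infimum in \<^typ>\<open>enat\<close> is a minimum
  if some such \<open>G\<close> exists, and \<open>\<infinity>\<close> otherwise.
\<close>

definition connected_size_ramsey :: "'b graph \<Rightarrow> 'c graph \<Rightarrow> enat" where
  "connected_size_ramsey G1 G2 =
     (INF G \<in> {G :: nat graph. simple_graph G \<and> connected_graph G \<and> arrows G G1 G2}.
        enat (card (edges G)))"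

definition matching_graph :: "nat \<Rightarrow> nat graph" where
  "matching_graph n = Graph {..<2 * n} ((\<lambda>i. {2 * i, 2 * i + 1}) ` {..<n})"

definition path_graph :: "nat \<Rightarrow> nat graph" where
  "path_graph k = Graph {..<k} {{i, i + 1} | i. i + 1 < k}"

lemma simple_graph_matching_graph: "simple_graph (matching_graph n)"
  by (auto simp: simple_graph_def matching_graph_def nsets_def)

lemma simple_graph_path_graph: "simple_graph (path_graph k)"
  by (auto simp: simple_graph_def path_graph_def nsets_def)

end

theory Submission
  imports Defs
begin

text \<open>
  Upper bound: a connected chain of disjoint 4-cycles, joined by single edges and followed by one
  \<open>P\<^sub>3\<close> if \<open>n\<close> is odd. If blue is a matching, each 4-cycle contains two disjoint red edges and
  the \<open>P\<^sub>3\<close> contains one.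

  Lower bound: every connected graph with \<open>m\<close> edges has a (blue) matching whose removal leaves
  matching number \<open>t\<close> with \<open>5 t \<le> 2 (m + 1)\<close>. Take a minimal counterexample. Deleting a vertex lowers
  the matching number by at most one, and single-edge components can be coloured blue for free, so
  the degree of every vertex \<open>v\<close> exceeds the number of components of \<open>G - v\<close> with an edge by at
  most 1. Choose \<open>v\<close> and a component \<open>D\<close> of \<open>G - v\<close> with at least two vertices and \<open>|D|\<close> minimal.
  For \<open>u \<in> D\<close> only the component of \<open>G - u\<close> that contains \<open>v\<close> can have an edge, so \<open>u\<close> has degree
  at most 2. Hence \<open>D\<close> is a path that starts at a neighbour of \<open>v\<close>. If it has two vertices, delete \<open>v\<close>
  and colour its edge blue; if it is \<open>a, y, z, \<dots>\<close>, delete \<open>v\<close> and \<open>z\<close> and colour \<open>ay\<close> blue. Either way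
  the remaining components satisfy the bound, and the edge count gives a contradiction.
\<close>

section \<open>Matchings and reachability in edge sets\<close>

definition matching :: "'a set set \<Rightarrow> bool" where
  "matching M \<longleftrightarrow> (\<forall>e\<in>M. \<forall>f\<in>M. e \<noteq> f \<longrightarrow> e \<inter> f = {})"

text \<open>\<open>M\<close> plays the blue class, which avoids \<open>P\<^sub>3\<close> because it
  is a matching; \<open>t\<close> bounds the red matchings that remain.\<close>

definition residual_matching_le :: "'a set set \<Rightarrow> nat \<Rightarrow> bool" where
  "residual_matching_le E t \<longleftrightarrow>
     (\<exists>M\<subseteq>E. matching M \<and> (\<forall>N\<subseteq>E - M. matching N \<longrightarrow> card N \<le> t))"

text \<open>Spelled as in \<open>connected_graph\<close>, so that connectivity of a graph transfers
  by unfolding.\<close>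

abbreviation reach :: "'a set set \<Rightarrow> 'a \<Rightarrow> 'a \<Rightarrow> bool" where
  "reach E x y \<equiv> (x, y) \<in> {(x, y). {x, y} \<in> E}\<^sup>*"

text \<open>Quantifying over covered vertices makes the empty edge set connected and lets edge sets
  stand in for graphs.\<close>

definition connected_edges :: "'a set set \<Rightarrow> bool" where
  "connected_edges E \<longleftrightarrow> (\<forall>x\<in>\<Union>E. \<forall>y\<in>\<Union>E. reach E x y)"

definition del :: "'a set set \<Rightarrow> 'a set \<Rightarrow> 'a set set" where
  "del E X = {e \<in> E. e \<inter> X = {}}"

definition nbrs :: "'a set set \<Rightarrow> 'a \<Rightarrow> 'a set" where
  "nbrs E v = {w. {v, w} \<in> E}"

text \<open>
  The size of a set \<open>R\<close> meeting every component replaces the number of components, which is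
  therefore never needed.
\<close>

definition hits :: "'a set \<Rightarrow> 'a set set \<Rightarrow> bool" where
  "hits R E \<longleftrightarrow> (\<forall>x\<in>\<Union>E. \<exists>r\<in>R. reach E r x)"

text \<open>For an integer \<open>card E\<close> the inequality says that it is at least the floor
  of \<open>(5 * t - 1) / 2\<close>.\<close>

definition bounded :: "'a set set \<Rightarrow> bool" where
  "bounded E \<longleftrightarrow> (\<exists>t. residual_matching_le E t \<and> 5 * t \<le> 2 * (card E + 1))"

lemma matching_subset: "matching M \<Longrightarrow> N \<subseteq> M \<Longrightarrow> matching N"
  unfolding matching_def by blast

lemma matching_Un:
  assumes "matching A" "matching B" "\<Union>A \<inter> \<Union>B = {}"
  shows "matching (A \<union> B)"
proof -
  have "e \<inter> f = {}" if "e \<in> A" "f \<in> B" for e f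
    using that assms(3) by blast
  then show ?thesis
    using assms(1,2) unfolding matching_def by (metis Int_commute Un_iff)
qed

lemma reach_sym: "reach E x y \<Longrightarrow> reach E y x"
proof (induction rule: rtrancl_induct)
  case (step y z)
  then have "reach E z y" by (auto simp: insert_commute)
  with step.IH show ?case by (rule rtrancl_trans[rotated])
qed simp

lemma reach_step: "reach E x y \<Longrightarrow> {y, z} \<in> E \<Longrightarrow> reach E x z"
  by (rule rtrancl_into_rtrancl) auto

lemma reach_from_common: "reach E r x \<Longrightarrow> reach E r y \<Longrightarrow> reach E x y"
  by (rule rtrancl_trans[OF reach_sym])

lemma reach_del_avoids: "reach (del E X) a w \<Longrightarrow> a \<notin> X \<Longrightarrow> w \<notin> X"
  by (induction rule: rtrancl_induct) (auto simp: del_def)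

section \<open>Residual bounds under disjoint union and deletion\<close>

lemma residual_matching_le_Un:
  assumes "residual_matching_le A s" "residual_matching_le B t" "\<Union>A \<inter> \<Union>B = {}"
  shows "residual_matching_le (A \<union> B) (s + t)"
proof -
  obtain M where M: "M \<subseteq> A" "matching M" "\<And>N. N \<subseteq> A - M \<Longrightarrow> matching N \<Longrightarrow> card N \<le> s"
    using assms(1) unfolding residual_matching_le_def by blast
  obtain M' where M': "M' \<subseteq> B" "matching M'" "\<And>N. N \<subseteq> B - M' \<Longrightarrow> matching N \<Longrightarrow> card N \<le> t"
    using assms(2) unfolding residual_matching_le_def by blast
  have "matching (M \<union> M')"
    by (rule matching_Un[OF M(2) M'(2)]) (use M(1) M'(1) assms(3) in blast)
  moreover have "card N \<le> s + t" if N: "N \<subseteq> A \<union> B - (M \<union> M')" "matching N" for N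
  proof -
    have "card (N \<inter> A) \<le> s" "card (N \<inter> B) \<le> t"
      using N by (auto intro!: M(3) M'(3) intro: matching_subset)
    moreover have "(N \<inter> A) \<union> (N \<inter> B) = N" using N by auto
    ultimately show ?thesis using card_Un_le[of "N \<inter> A" "N \<inter> B"] by simp
  qed
  ultimately show ?thesis
    unfolding residual_matching_le_def using M(1) M'(1)
    by (intro exI[of _ "M \<union> M'"]) auto
qed

text \<open>The edges of \<open>F\<close> join the blue matching, as they are disjoint from those of
  \<open>A\<close>. A red matching then consists of edges of \<open>A\<close> and edges meeting
  \<open>S\<close>; the latter are pairwise disjoint, so picking a vertex of \<open>S\<close> in
  each is injective.\<close>

lemma residual_matching_le_delete:
  fixes E :: "'a set set"
  assumes "residual_matching_le A t" "A \<subseteq> E" "F \<subseteq> E" "matching F" "\<Union>F \<inter> \<Union>A = {}"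
    and "E \<subseteq> A \<union> F \<union> {e. e \<inter> S \<noteq> {}}" "finite S" "finite E"
  shows "residual_matching_le E (t + card S)"
proof -
  obtain M where M: "M \<subseteq> A" "matching M" "\<And>N. N \<subseteq> A - M \<Longrightarrow> matching N \<Longrightarrow> card N \<le> t"
    using assms(1) unfolding residual_matching_le_def by blast
  have "matching (M \<union> F)"
    by (rule matching_Un[OF M(2) assms(4)]) (use M(1) assms(5) in blast)
  moreover have "card N \<le> t + card S" if N: "N \<subseteq> E - (M \<union> F)" "matching N" for N
  proof -
    let ?K = "{e \<in> N. e \<inter> S \<noteq> {}}"
    have finN: "finite N" using N(1) assms(8) finite_subset by blast
    have "card (N \<inter> A) \<le> t"
      using N by (auto intro!: M(3) intro: matching_subset)
    moreover have "card ?K \<le> card S"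
    proof -
      define g where "g e = (SOME x. x \<in> e \<inter> S)" for e :: "'a set"
      have g: "g e \<in> e \<inter> S" if "e \<in> ?K" for e
        unfolding some_in_eq g_def using that by simp
      have "inj_on g ?K"
      proof (rule inj_onI)
        fix e f assume "e \<in> ?K" "f \<in> ?K" "g e = g f"
        then have "e \<inter> f \<noteq> {}" using g[of e] g[of f] by auto
        with \<open>e \<in> ?K\<close> \<open>f \<in> ?K\<close> N(2) show "e = f" unfolding matching_def by blast
      qed
      moreover have "g ` ?K \<subseteq> S" using g by blast
      ultimately show ?thesis using assms(7) card_inj_on_le by blast
    qed
    moreover have "N \<subseteq> (N \<inter> A) \<union> ?K" using N(1) assms(6) by blast
    then have "card N \<le> card ((N \<inter> A) \<union> ?K)" using finN by (intro card_mono) auto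
    then have "card N \<le> card (N \<inter> A) + card ?K"
      using card_Un_le order_trans by blast
    ultimately show ?thesis by linarith
  qed
  moreover have "M \<union> F \<subseteq> E" using M(1) assms(2,3) by blast
  ultimately show ?thesis
    unfolding residual_matching_le_def by blast
qed

text \<open>Induction on \<open>R\<close>: the component \<open>C\<close> of one root is split off,
  and the other roots still hit the rest. Each root pays for the \<open>+ 1\<close> that
  \<open>bounded\<close> grants to one component; a root that reaches no edge has
  \<open>C = {}\<close> and only adds slack.\<close>

lemma hits_residual_matching_le:
  assumes "finite R" "finite A" "\<forall>e\<in>A. card e = 2" "hits R A"
    and "\<And>C. C \<subseteq> A \<Longrightarrow> connected_edges C \<Longrightarrow> bounded C"
  shows "\<exists>t. residual_matching_le A t \<and> 5 * t \<le> 2 * (card A + card R)"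
  using assms
proof (induction R arbitrary: A rule: finite_induct)
  case empty
  have "A = {}"
  proof (rule ccontr)
    assume "A \<noteq> {}"
    then obtain e where "e \<in> A" by blast
    moreover from this have "e \<noteq> {}" using empty by auto
    ultimately show False using empty unfolding hits_def by blast
  qed
  then have "residual_matching_le A 0"
    unfolding residual_matching_le_def matching_def by auto
  then show ?case by auto
next
  case (insert r R)
  define C where "C = {e \<in> A. \<exists>x\<in>e. reach A r x}"
  have pair: "\<exists>x y. e = {x, y}" if "e \<in> A" for e
    using that insert.prems by (metis card_2_iff)
  have C_all: "reach A r y" if "e \<in> C" "y \<in> e" for e y
  proof -
    from that obtain x where x: "e \<in> A" "x \<in> e" "reach A r x" unfolding C_def by blast
    obtain a b where "e = {a, b}" using pair x by blast
    then have "x = y \<or> {x, y} \<in> A" using x that by (auto simp: insert_commute)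
    then show ?thesis using x(3) reach_step[OF x(3)] by blast
  qed
  have reachC: "reach C r x" if "reach A r x" for x
    using that
  proof (induction rule: rtrancl_induct)
    case (step y z)
    then have "{y, z} \<in> C" unfolding C_def by auto
    with step.IH show ?case by (rule reach_step)
  qed simp
  have "connected_edges C"
    unfolding connected_edges_def
  proof (intro ballI)
    fix x y assume "x \<in> \<Union>C" "y \<in> \<Union>C"
    then have "reach C r x" "reach C r y" using C_all reachC by auto
    then show "reach C x y" by (rule reach_from_common)
  qed
  have CA: "C \<subseteq> A" unfolding C_def by blast
  obtain s where s: "residual_matching_le C s" "5 * s \<le> 2 * (card C + 1)"
    using insert.prems(4)[OF CA \<open>connected_edges C\<close>] unfolding bounded_def by blast
  have disj: "\<Union>C \<inter> \<Union>(A - C) = {}"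
    using C_all unfolding C_def by fastforce
  have "hits R (A - C)"
    unfolding hits_def
  proof
    fix x assume x: "x \<in> \<Union>(A - C)"
    then obtain r' where r': "r' \<in> insert r R" "reach A r' x"
      using insert.prems(3) unfolding hits_def by blast
    have nr: "\<not> reach A r x" using x unfolding C_def by blast
    then have "r' \<in> R" using r' by auto
    \<comment> \<open>A path that starts outside the component of \<open>r\<close> never enters it,
      so it survives the removal of \<open>C\<close>.\<close>
    have "reach A x r'" using r'(2) by (rule reach_sym)
    then have "reach (A - C) x r'"
    proof (induction rule: rtrancl_induct)
      case (step y z)
      have "\<not> reach A r y" 
        using nr rtrancl_trans[OF _ reach_sym[OF step.hyps(1)]] by blast
      moreover have "{y, z} \<notin> C" using C_all[of "{y, z}" y] calculation by blast
      ultimately have "{y, z} \<in> A - C" using step.hyps by auto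
      with step.IH show ?case by (rule reach_step)
    qed simp
    from \<open>r' \<in> R\<close> reach_sym[OF this] show "\<exists>r\<in>R. reach (A - C) r x" by blast
  qed
  moreover have "finite (A - C)" "\<forall>e\<in>A - C. card e = 2" using insert.prems by auto
  moreover have "\<And>D. D \<subseteq> A - C \<Longrightarrow> connected_edges D \<Longrightarrow> bounded D"
    using insert.prems(4) by blast
  ultimately obtain t where t: "residual_matching_le (A - C) t"
      "5 * t \<le> 2 * (card (A - C) + card R)"
    using insert.IH by metis
  have "residual_matching_le (C \<union> (A - C)) (s + t)"
    using residual_matching_le_Un[OF s(1) t(1) disj] .
  moreover have "C \<union> (A - C) = A" using CA by blast
  moreover have "card A = card C + card (A - C)"
    using CA insert.prems(1) by (metis card_Diff_subset card_mono finite_subset le_add_diff_inverse)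
  ultimately show ?case
    using s(2) t(2) insert.hyps by (intro exI[of _ "s + t"]) auto
qed

section \<open>The lower bound\<close>

text \<open>The bound is available for connected proper subsets, and the components left by a
  deletion are such subsets.\<close>

locale minimal_counterexample =
  fixes E :: "'a set set"
  assumes finite_E: "finite E"
    and card_edge: "\<And>e. e \<in> E \<Longrightarrow> card e = 2"
    and connected_E: "connected_edges E"
    and not_bounded: "\<not> bounded E"
    and smaller_bounded: "\<And>C. C \<subset> E \<Longrightarrow> connected_edges C \<Longrightarrow> bounded C"
begin

lemma edge_neq: "{x, y} \<in> E \<Longrightarrow> x \<noteq> y"
  using card_edge by fastforce

lemma edge_nonempty: "e \<in> E \<Longrightarrow> \<exists>x. x \<in> e"
  using card_edge[of e] by (cases "e = {}") auto

lemma edge_pair: "e \<in> E \<Longrightarrow> x \<in> e \<Longrightarrow> \<exists>y. e = {x, y}"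
  using card_edge[of e] by (auto simp: card_2_iff insert_commute)

lemma finite_Union_E: "finite (\<Union>E)"
  using finite_E card_edge by (metis card.infinite finite_Union zero_neq_numeral)

lemma nbrs_subset: "nbrs E v \<subseteq> \<Union>E"
  by (auto simp: nbrs_def)

lemma finite_nbrs: "finite (nbrs E v)"
  using nbrs_subset finite_Union_E finite_subset by blast

lemma card_incident: "card {e \<in> E. v \<in> e} = card (nbrs E v)"
proof -
  have "{e \<in> E. v \<in> e} = (\<lambda>w. {v, w}) ` nbrs E v"
    using edge_pair by (fastforce simp: nbrs_def)
  moreover have "inj_on (\<lambda>w. {v, w}) (nbrs E v)"
    by (auto simp: inj_on_def doubleton_eq_iff)
  ultimately show ?thesis by (simp add: card_image)
qed

text \<open>Otherwise the bounds of the components of \<open>A\<close>, summed over the roots in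
  \<open>R\<close>, together with the loss of \<open>card S\<close> would make \<open>E\<close>
  bounded by \<open>t + card S\<close>. The arguments below choose \<open>S\<close>,
  \<open>F\<close> and \<open>R\<close> against this inequality.\<close>

lemma deletion_bound:
  assumes "A \<subset> E" "F \<subseteq> E" "matching F" "\<Union>F \<inter> \<Union>A = {}"
    and "E \<subseteq> A \<union> F \<union> {e. e \<inter> S \<noteq> {}}" "finite S" "finite R" "hits R A"
  shows "2 * (card E + 1) < 2 * (card A + card R) + 5 * card S"
proof (rule ccontr)
  assume *: "\<not> ?thesis"
  have "finite A" "\<forall>e\<in>A. card e = 2" 
    using assms(1) finite_E card_edge finite_subset by auto
  moreover have "\<And>C. C \<subseteq> A \<Longrightarrow> connected_edges C \<Longrightarrow> bounded C"
    using smaller_bounded assms(1) by blast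
  ultimately obtain t where t: "residual_matching_le A t" "5 * t \<le> 2 * (card A + card R)"
    using hits_residual_matching_le assms(7,8) by metis
  have "residual_matching_le E (t + card S)"
    using residual_matching_le_delete[OF t(1) _ assms(2-6) finite_E] assms(1) by blast
  then have "bounded E"
    unfolding bounded_def using t(2) * by (intro exI[of _ "t + card S"]) auto
  then show False using not_bounded by simp
qed

text \<open>Cut a path from \<open>v\<close> to \<open>x\<close> after its last vertex in
  \<open>X\<close>: the remainder lies in \<open>del E X\<close> and starts at \<open>r\<close>.
  Thus the outer neighbours of \<open>X\<close> hit \<open>del E X\<close>.\<close>

lemma reach_outside:
  assumes "v \<in> X" "v \<in> \<Union>E" "x \<in> \<Union>E" "x \<notin> X"
  shows "\<exists>r u. u \<in> X \<and> r \<notin> X \<and> {u, r} \<in> E \<and> reach (del E X) r x"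
proof -
  have "reach E v x" using connected_E assms unfolding connected_edges_def by blast
  then show ?thesis using assms(4)
  proof (induction rule: rtrancl_induct)
    case base
    then show ?case using assms(1) by blast
  next
    case (step y z)
    then have yz: "{y, z} \<in> E" by auto
    show ?case
    proof (cases "y \<in> X")
      case True
      then show ?thesis using yz step.prems by blast
    next
      case False
      then obtain r u where r: "u \<in> X" "r \<notin> X" "{u, r} \<in> E" "reach (del E X) r y"
        using step.IH by blast
      have "{y, z} \<in> del E X" using yz False step.prems by (auto simp: del_def)
      then have "reach (del E X) r z" by (rule reach_step[OF r(4)])
      then show ?thesis using r by blast
    qed
  qed
qed

text \<open>Apply \<open>deletion_bound\<close> with \<open>S = {v}\<close> and
  \<open>F = {}\<close>. For the degree \<open>d\<close> of \<open>v\<close> it reads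
  \<open>2 * d + 2 < 2 * card R + 5\<close>.\<close>

lemma degree_le:
  assumes "v \<in> \<Union>E" "finite R" "hits R (del E {v})"
  shows "card (nbrs E v) \<le> card R + 1"
proof -
  have "{e \<in> E. v \<in> e} \<noteq> {}" using assms(1) by blast
  then have "del E {v} \<subset> E" by (auto simp: del_def)
  then have "2 * (card E + 1) < 2 * (card (del E {v}) + card R) + 5 * card {v}"
    by (rule deletion_bound[where F = "{}"]) (use assms in \<open>auto simp: matching_def del_def\<close>)
  moreover have "card E = card (del E {v}) + card {e \<in> E. v \<in> e}"
    using finite_E by (subst card_Un_disjoint[symmetric]) (auto simp: del_def intro!: arg_cong[where f = card])
  ultimately show ?thesis by (simp add: card_incident)
qed

section \<open>Components after the deletion of one vertex\<close>

definition component :: "'a \<Rightarrow> 'a \<Rightarrow> 'a set" where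
  "component v a = {w. reach (del E {v}) a w}"

lemma self_in_component: "a \<in> component v a"
  by (simp add: component_def)

lemma finite_component: "finite (component v a)"
proof -
  have "w \<in> insert a (\<Union>E)" if "reach (del E {v}) a w" for w
    using that by (induction rule: rtrancl_induct) (auto simp: del_def)
  then have "component v a \<subseteq> insert a (\<Union>E)" unfolding component_def by blast
  then show ?thesis using finite_Union_E finite_subset by blast
qed

lemma component_step:
  "x \<in> component v a \<Longrightarrow> {x, y} \<in> E \<Longrightarrow> x \<noteq> v \<Longrightarrow> y \<noteq> v \<Longrightarrow> y \<in> component v a"
  unfolding component_def mem_Collect_eq
  by (erule reach_step) (auto simp: del_def)

lemma notin_component: "a \<in> nbrs E v \<Longrightarrow> v \<notin> component v a"
  using reach_del_avoids[where X = "{v}" and a = a and w = v] edge_neq by (auto simp: component_def nbrs_def)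

text \<open>Paths from \<open>b\<close> that avoid \<open>u\<close> and never meet \<open>v\<close>
  stay in the component of \<open>u\<close> in \<open>E - v\<close>; they miss \<open>u\<close>
  itself, so the inclusion is strict. This is the descent that minimality will forbid.\<close>

lemma component_psubset:
  assumes "a \<in> nbrs E v" "u \<in> component v a" "b \<in> nbrs E u" "v \<notin> component u b"
  shows "component u b \<subset> component v a"
proof -
  have uv: "u \<noteq> v" using assms(1,2) notin_component by blast
  have "x \<in> component v a" if "reach (del E {u}) b x" for x
    using that
  proof (induction rule: rtrancl_induct)
    case base
    have "b \<noteq> v" using assms(4) self_in_component by metis
    then show ?case using component_step[OF assms(2)] assms(3) uv by (auto simp: nbrs_def)
  next
    case (step y z)
    have "y \<in> component u b" "z \<in> component u b"
      using step.hyps unfolding component_def by (auto intro: rtrancl_into_rtrancl)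
    then have "y \<noteq> v" "z \<noteq> v" using assms(4) by auto
    then show ?case using component_step[OF step.IH] step.hyps by (auto simp: del_def)
  qed
  moreover have "u \<notin> component u b" using notin_component assms(3) .
  ultimately show ?thesis using assms(2) unfolding component_def by blast
qed

text \<open>\<open>reach_outside\<close> with \<open>X = {v}\<close> finds \<open>a\<close>, and the
  two ends of \<open>e\<close> account for the size. Hence only components with at least two
  vertices matter when \<open>del E {v}\<close> is to be hit.\<close>

lemma component_of_edge:
  assumes "v \<in> \<Union>E" "e \<in> del E {v}" "x \<in> e"
  shows "\<exists>a\<in>nbrs E v. x \<in> component v a \<and> 2 \<le> card (component v a)"
proof -
  obtain y where y: "e = {x, y}" using edge_pair assms by (auto simp: del_def)
  then have xy: "{x, y} \<in> E" "x \<noteq> v" "y \<noteq> v" using assms by (auto simp: del_def)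
  then obtain a where a: "a \<in> nbrs E v" "x \<in> component v a"
    using reach_outside[of v "{v}" x] assms(1) by (auto simp: nbrs_def component_def)
  then have "y \<in> component v a" using component_step xy by blast
  then have "card {x, y} \<le> card (component v a)"
    using a finite_component by (intro card_mono) auto
  then show ?thesis using a edge_neq[OF xy(1)] by auto
qed

section \<open>The smallest component and its path structure\<close>

lemma no_counterexample: False
proof -
  have "\<not> card E \<le> 1"
  proof
    assume *: "card E \<le> 1"
    have "matching E"
      unfolding matching_def using * card_le_Suc0_iff_eq[OF finite_E] by auto
    then have "residual_matching_le E 0"
      unfolding residual_matching_le_def by (intro exI[of _ E]) auto
    then show False using not_bounded unfolding bounded_def by auto
  qed
  then have card_E: "2 \<le> card E" by simp
  define P where "P p = (case p of (v, a) \<Rightarrow> v \<in> \<Union>E \<and> a \<in> nbrs E v \<and> 2 \<le> card (component v a))" for p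
  \<comment> \<open>Without such a component all edges meet in \<open>v\<close>, and
    \<open>degree_le\<close> with the empty hitting set allows just one edge.\<close>
  have "\<exists>p. P p"
  proof (rule ccontr)
    assume none: "\<nexists>p. P p"
    obtain e where "e \<in> E" using card_E by fastforce
    then obtain v where v: "v \<in> \<Union>E" using edge_nonempty by blast
    have "del E {v} = {}"
    proof (rule ccontr)
      assume "del E {v} \<noteq> {}"
      then obtain e where e: "e \<in> del E {v}" by blast
      then obtain x where "x \<in> e" using edge_nonempty[of e] by (auto simp: del_def)
      then show False using component_of_edge[OF v e] none v unfolding P_def by auto
    qed
    then have "{e \<in> E. v \<in> e} = E" by (auto simp: del_def)
    then have "card (nbrs E v) = card E" using card_incident[of v] by simp
    moreover have "card (nbrs E v) \<le> card ({}::'a set) + 1"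
      by (rule degree_le[OF v]) (auto simp: hits_def \<open>del E {v} = {}\<close>)
    ultimately show False using card_E by simp
  qed
  then obtain p where p: "P p" "\<And>q. P q \<Longrightarrow> card (component (fst p) (snd p)) \<le> card (component (fst q) (snd q))"
    using ex_has_least_nat[of P _ "\<lambda>q. card (component (fst q) (snd q))"] by blast
  obtain v a where "p = (v, a)" by (cases p)
  then have v: "v \<in> \<Union>E" and a: "a \<in> nbrs E v" and card_va: "2 \<le> card (component v a)"
    using p(1) unfolding P_def by auto
  \<comment> \<open>A component without \<open>v\<close> would be strictly smaller than the chosen
    one.\<close>
  have contains_v: "v \<in> component u b"
    if "u \<in> component v a" "b \<in> nbrs E u" "2 \<le> card (component u b)" for u b
  proof (rule ccontr)
    assume "v \<notin> component u b"
    then have "component u b \<subset> component v a" using component_psubset a that by blast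
    then have "card (component u b) < card (component v a)"
      using finite_component psubset_card_mono by blast
    moreover have "P (u, b)" using that unfolding P_def by (auto simp: nbrs_def)
    ultimately show False using p(2)[of "(u, b)"] \<open>p = (v, a)\<close> by simp
  qed
  have deg: "card (nbrs E u) \<le> 2" if u: "u \<in> component v a" "u \<in> \<Union>E" for u
  proof -
    \<comment> \<open>Every edge of \<open>E - u\<close> lies in a component that contains
      \<open>v\<close>, so the single root \<open>v\<close> suffices and the degree is at most
      2.\<close>
    have "hits {v} (del E {u})"
      unfolding hits_def
    proof
      fix x assume "x \<in> \<Union>(del E {u})"
      then obtain b where b: "b \<in> nbrs E u" "x \<in> component u b" "2 \<le> card (component u b)"
        using component_of_edge[OF u(2)] by blast
      then have "reach (del E {u}) b v" "reach (del E {u}) b x"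
        using contains_v u(1) unfolding component_def by blast+
      then have "reach (del E {u}) v x" by (rule reach_from_common)
      then show "\<exists>r\<in>{v}. reach (del E {u}) r x" by simp
    qed
    then have "card (nbrs E u) \<le> card {v} + 1" by (intro degree_le u) simp_all
    then show ?thesis by simp
  qed
  have nbrs_eq: "nbrs E u = {x, y}"
    if "u \<in> component v a" "{u, x} \<in> E" "{u, y} \<in> E" "x \<noteq> y" for u x y
  proof -
    have "{x, y} \<subseteq> nbrs E u" using that by (auto simp: nbrs_def)
    moreover have "card (nbrs E u) \<le> card {x, y}" using deg[OF that(1)] that(2,4) by fastforce
    ultimately show ?thesis using finite_nbrs card_seteq by metis
  qed
  have va: "{v, a} \<in> E" "v \<noteq> a" using a edge_neq by (auto simp: nbrs_def)
  have aC: "a \<in> component v a" by (rule self_in_component)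
  obtain y where y: "{a, y} \<in> E" "y \<noteq> v"
  proof -
    have "component v a \<noteq> {a}" using card_va by auto
    then obtain w where "reach (del E {v}) a w" "w \<noteq> a"
      using aC unfolding component_def by blast
    then obtain y where "{a, y} \<in> del E {v}"
      by (auto elim: converse_rtranclE)
    then show ?thesis using that by (auto simp: del_def)
  qed
  have ay: "a \<noteq> y" using edge_neq y by blast
  have yC: "y \<in> component v a" using component_step aC y va by blast
  have Na: "nbrs E a = {v, y}" using nbrs_eq[OF aC] va y by (auto simp: insert_commute)
  show False
  proof (cases "nbrs E y \<subseteq> {a, v}")
    case True
    \<comment> \<open>Take \<open>S = {v}\<close> and \<open>F = {{a, y}}\<close>. For the degree
      \<open>d\<close> of \<open>v\<close>, \<open>card E = card A + 1 + d\<close> and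
      \<open>card R \<le> d - 1\<close> turn \<open>deletion_bound\<close> into
      \<open>2 * d + 4 < 2 * d + 3\<close>.\<close>
    define A where "A = del E {v, a, y}"
    define R where "R = nbrs E v - {a, y}"
    have inc: "e = {v, a} \<or> e = {a, y} \<or> e = {v, y}" if e: "e \<in> E" "a \<in> e \<or> y \<in> e" for e
      using e(2)
    proof
      assume "a \<in> e"
      then obtain w where "e = {a, w}" using edge_pair[OF e(1)] by blast
      then have "w \<in> nbrs E a" "e = {a, w}" using e(1) by (simp_all add: nbrs_def)
      then show ?thesis using Na by auto
    next
      assume "y \<in> e"
      then obtain w where "e = {y, w}" using edge_pair[OF e(1)] by blast
      then have "w \<in> nbrs E y" "e = {y, w}" using e(1) by (simp_all add: nbrs_def)
      then show ?thesis using True by auto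
    qed
    have split: "E = A \<union> {{a, y}} \<union> {e \<in> E. v \<in> e}"
      using inc y(1) by (auto simp: A_def del_def)
    have "hits R A"
      unfolding hits_def
    proof
      fix x assume x: "x \<in> \<Union>A"
      then have "x \<in> \<Union>E" "x \<notin> {v, a, y}" by (auto simp: A_def del_def)
      then obtain r u where r: "u \<in> {v, a, y}" "r \<notin> {v, a, y}" "{u, r} \<in> E" "reach A r x"
        using reach_outside[of v "{v, a, y}" x] v unfolding A_def by blast
      have "u = v" using r inc[of "{u, r}"] by (auto simp: doubleton_eq_iff)
      then show "\<exists>r\<in>R. reach A r x" using r by (auto simp: R_def nbrs_def)
    qed
    then have "2 * (card E + 1) < 2 * (card A + card R) + 5 * card {v}"
      by (intro deletion_bound[where F = "{{a, y}}"])
        (use split va y finite_nbrs in \<open>auto simp: A_def del_def matching_def R_def\<close>)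
    moreover have "card E = card A + 1 + card (nbrs E v)"
    proof -
      have "card E = card (A \<union> {{a, y}}) + card {e \<in> E. v \<in> e}"
        using finite_E va y
        by (subst split, subst card_Un_disjoint) (auto simp: A_def del_def)
      moreover have "card (A \<union> {{a, y}}) = card A + 1"
        using finite_E by (subst card_Un_disjoint) (auto simp: A_def del_def)
      ultimately show ?thesis by (simp add: card_incident)
    qed
    moreover have "card R < card (nbrs E v)"
      unfolding R_def using a finite_nbrs by (intro psubset_card_mono) auto
    ultimately show False by simp
  next
    case False
    then obtain z where z: "{y, z} \<in> E" "z \<noteq> a" "z \<noteq> v" by (auto simp: nbrs_def)
    have yz: "y \<noteq> z" using edge_neq z by blast
    have zC: "z \<in> component v a" using component_step yC z y by blast
    have Ny: "nbrs E y = {a, z}" using nbrs_eq[OF yC] y z by (auto simp: insert_commute)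
    define X where "X = {v, a, y, z}"
    define A where "A = del E X"
    have y_nbr: "y \<in> nbrs E a" using y by (simp add: nbrs_def)
    \<comment> \<open>\<open>component a y\<close> contains \<open>y\<close> and \<open>z\<close>,
      hence also \<open>v\<close>: avoiding \<open>a\<close>, the path from \<open>y\<close> goes on
      past \<open>z\<close> up to \<open>v\<close>. This yields \<open>w\<close> and later
      \<open>b\<close>.\<close>
    have "z \<in> component a y"
      using component_step[OF self_in_component] z ay by metis
    then have "card {y, z} \<le> card (component a y)"
      by (intro card_mono finite_component) (auto simp: self_in_component)
    then have v_y: "reach (del E {a}) y v"
      using contains_v[OF aC y_nbr] yz unfolding component_def by auto
    \<comment> \<open>If \<open>z\<close> had no neighbour besides \<open>y\<close>, then
      \<open>y\<close> would reach only \<open>y\<close> and \<open>z\<close> in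
      \<open>E - a\<close>, and not \<open>v\<close>.\<close>
    obtain w where w: "{z, w} \<in> E" "w \<noteq> y"
    proof (rule ccontr)
      assume "\<not> thesis"
      then have Nz: "{z, w} \<in> E \<Longrightarrow> w = y" for w using that by blast
      have "x \<in> {y, z}" if "reach (del E {a}) y x" for x
        using that
      proof (induction rule: rtrancl_induct)
        case (step s t)
        then have "t \<in> nbrs E s" "t \<noteq> a" by (auto simp: del_def nbrs_def)
        moreover have "t = y" if "s = z" using Nz that calculation(1) by (auto simp: nbrs_def)
        ultimately show ?case using step.IH Ny by auto
      qed simp
      then show False using v_y y z by blast
    qed
    have Nz: "nbrs E z = {y, w}" using nbrs_eq[OF zC, of y w] w z by (auto simp: insert_commute)
    have "w \<noteq> a"
    proof
      assume "w = a"
      then have "z \<in> nbrs E a" using w by (simp add: nbrs_def insert_commute)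
      then show False using Na z yz by auto
    qed
    moreover have "w \<noteq> z" using edge_neq w by blast
    ultimately have wa: "w \<noteq> a" "w \<noteq> z" by auto
    have inc: "e \<in> {{v, a}, {a, y}, {y, z}, {z, w}}" if e: "e \<in> E" "u \<in> e" "u \<in> {a, y, z}" for e u
    proof -
      obtain s where s: "e = {u, s}" using edge_pair e by blast
      have "s \<in> nbrs E u" using s e by (simp add: nbrs_def)
      then show ?thesis using e(3) s Na Ny Nz by auto
    qed
    have split: "E = A \<union> {{a, y}, {y, z}} \<union> {{z, w}} \<union> {e \<in> E. v \<in> e}"
      using inc y z w by (auto simp: A_def X_def del_def)
    \<comment> \<open>With \<open>S = {v, z}\<close> and \<open>F = {{a, y}}\<close> the term
      \<open>5 * card S\<close> is 10, and the surplus 4 in the assumption gives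
      \<open>2 * (4 + 1) = 10\<close>, so the strict inequality fails.\<close>
    have main: False
      if R: "finite R" "hits R A" "card A + card R + 4 \<le> card E" for R
    proof -
      have "A \<subseteq> E" "{a, y} \<notin> A" by (auto simp: A_def X_def del_def)
      then have "A \<subset> E" using y(1) by blast
      moreover have "e \<in> A \<union> {{a, y}} \<union> {e. e \<inter> {v, z} \<noteq> {}}" if "e \<in> E" for e
      proof -
        have "e \<in> A \<union> {{a, y}, {y, z}} \<union> {{z, w}} \<union> {e \<in> E. v \<in> e}"
          by (rule equalityD1[OF split, THEN subsetD, OF that])
        then show ?thesis by auto
      qed
      moreover have "matching {{a, y}}" by (simp add: matching_def)
      moreover have "\<Union>{{a, y}} \<inter> \<Union>A = {}" by (auto simp: A_def X_def del_def)
      ultimately have "2 * (card E + 1) < 2 * (card A + card R) + 5 * card {v, z}"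
        using y(1) R(1,2) by (intro deletion_bound[where F = "{{a, y}}"]) auto
      moreover have "card {v, z} = 2" using z by simp
      ultimately show False using R(3) by simp
    qed
    have hit: "\<exists>r. (r \<in> nbrs E v \<or> r = w) \<and> r \<notin> X \<and> reach A r x" if x: "x \<in> \<Union>A" for x
    proof -
      have "x \<in> \<Union>E" "x \<notin> X" using x by (auto simp: A_def del_def)
      then obtain r u where r: "u \<in> X" "r \<notin> X" "{u, r} \<in> E" "reach A r x"
        using reach_outside[of v X x] v unfolding A_def X_def by blast
      have "u = v \<or> r = w"
        using r inc[of "{u, r}" u] by (auto simp: X_def doubleton_eq_iff)
      then show ?thesis using r by (auto simp: nbrs_def)
    qed
    have cA: "card (A \<union> {{a, y}, {y, z}}) = card A + 2"
    proof -
      have "{a, y} \<noteq> {y, z}" using z by (auto simp: doubleton_eq_iff)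
      then show ?thesis
        using finite_E by (subst card_Un_disjoint) (auto simp: A_def X_def del_def)
    qed
    show False
    proof (cases "w = v")
      case True
      \<comment> \<open>Now \<open>v, a, y, z\<close> form a 4-cycle. The edge \<open>zw\<close>
        counts among the \<open>d\<close> edges at \<open>v\<close>, so
        \<open>card E = card A + 2 + d\<close>, and both \<open>a\<close> and \<open>z\<close> leave
        the hitting set, so \<open>card R = d - 2\<close>.\<close>
      define R where "R = nbrs E v - {a, z}"
      have "card E = card (A \<union> {{a, y}, {y, z}}) + card {e \<in> E. v \<in> e}"
      proof -
        have "{{z, w}} \<union> {e \<in> E. v \<in> e} = {e \<in> E. v \<in> e}" using w True by auto
        then have "E = A \<union> {{a, y}, {y, z}} \<union> {e \<in> E. v \<in> e}" using split by (metis Un_assoc)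
        then have "card E = card (A \<union> {{a, y}, {y, z}} \<union> {e \<in> E. v \<in> e})" by (rule arg_cong)
        also have "\<dots> = card (A \<union> {{a, y}, {y, z}}) + card {e \<in> E. v \<in> e}"
          using finite_E va y z by (intro card_Un_disjoint) (auto simp: A_def X_def del_def)
        finally show ?thesis .
      qed
      then have cE: "card E = card A + 2 + card (nbrs E v)" using cA card_incident by simp
      have "{a, z} \<subseteq> nbrs E v" using a w True by (auto simp: nbrs_def insert_commute)
      then have "card R + 2 = card (nbrs E v)"
        unfolding R_def using finite_nbrs[of v] z(2) card_mono[of "nbrs E v" "{a, z}"]
        by (subst card_Diff_subset) auto
      moreover have "hits R A"
        unfolding hits_def R_def using hit True by (fastforce simp: X_def)
      ultimately show False using main[of R] cE finite_nbrs by (auto simp: R_def)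
    next
      case False
      then have wX: "w \<notin> X" using wa w by (auto simp: X_def)
      \<comment> \<open>Here \<open>card E = card A + 3 + d\<close>, so \<open>main\<close> demands
        \<open>card R \<le> d - 1\<close>, while \<open>nbrs E v - {a}\<close> with \<open>w\<close>
        added may have \<open>d\<close> elements. To save one, follow the path from \<open>y\<close>
        to \<open>v\<close> in \<open>E - a\<close>: it passes \<open>z\<close> and
        \<open>w\<close>, and just before \<open>v\<close> it is at a neighbour \<open>b\<close> of
        \<open>v\<close> reached from \<open>w\<close> inside \<open>A\<close>. The last alternative
        records such a \<open>b\<close> once found.\<close>
      have "x \<in> {y, z} \<or> reach A w x \<or> (\<exists>b\<in>nbrs E v - {a}. reach A w b)"
        if "reach (del E {a}) y x" for x
        using that
      proof (induction rule: rtrancl_induct)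
        case (step s t)
        have st: "{s, t} \<in> E" "s \<noteq> a" "t \<noteq> a" using step.hyps by (auto simp: del_def)
        from step.IH consider "s = y" | "s = z" | "reach A w s"
          | "\<exists>b\<in>nbrs E v - {a}. reach A w b" by blast
        then show ?case
        proof cases
          case 1
          then have "t \<in> nbrs E y" using st by (simp add: nbrs_def)
          then show ?thesis using st Ny by auto
        next
          case 2
          then have "t \<in> nbrs E z" using st by (simp add: nbrs_def)
          then show ?thesis using Nz by auto
        next
          case 3
          then have sX: "s \<notin> X" using reach_del_avoids[OF _ wX] unfolding A_def by blast
          show ?thesis
          proof (cases "t \<in> X")
            case True
            then consider "t = v" | "t \<in> {y, z}" using st by (auto simp: X_def)
            then show ?thesis
            proof cases
              case 1
              then have "s \<in> nbrs E v - {a}" using st by (auto simp: nbrs_def insert_commute)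
              then show ?thesis using 3 by blast
            qed blast
          next
            case False
            then have "{s, t} \<in> A" using st sX by (auto simp: A_def del_def)
            then show ?thesis using reach_step[OF 3] by blast
          qed
        qed blast
      qed simp
      then have "v \<in> {y, z} \<or> reach A w v \<or> (\<exists>b\<in>nbrs E v - {a}. reach A w b)"
        using v_y by blast
      moreover have "\<not> reach A w v"
        using reach_del_avoids[where X = X and a = w and w = v] wX unfolding A_def X_def by blast
      ultimately obtain b where b: "b \<in> nbrs E v" "b \<noteq> a" "reach A w b"
        using y z by blast
      \<comment> \<open>Since \<open>w\<close> reaches \<open>b\<close>, it can replace \<open>b\<close> in the hitting set.\<close>
      define R where "R = insert w (nbrs E v - {a, b})"
      have "card E = card (A \<union> {{a, y}, {y, z}} \<union> {{z, w}}) + card {e \<in> E. v \<in> e}"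
        using finite_E va y z False
        by (subst split, intro card_Un_disjoint) (auto simp: A_def X_def del_def)
      moreover have "card (A \<union> {{a, y}, {y, z}} \<union> {{z, w}}) = card A + 3"
      proof -
        have "{z, w} \<notin> A \<union> {{a, y}, {y, z}}"
          using w wa by (auto simp: A_def X_def del_def doubleton_eq_iff)
        then show ?thesis using cA finite_E by (simp add: A_def del_def)
      qed
      ultimately have cE: "card E = card A + 3 + card (nbrs E v)" using card_incident by simp
      have "{a, b} \<subseteq> nbrs E v" using a b by blast
      then have "card (nbrs E v - {a, b}) + 2 = card (nbrs E v)"
        using finite_nbrs[of v] b(2) card_mono[of "nbrs E v" "{a, b}"]
        by (subst card_Diff_subset) auto
      then have "card R + 1 \<le> card (nbrs E v)"
        unfolding R_def using finite_nbrs[of v]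
        by (simp add: card_insert_if)
      moreover have "hits R A"
        unfolding hits_def
      proof
        fix x assume "x \<in> \<Union>A"
        then obtain r where r: "r \<in> nbrs E v \<or> r = w" "r \<notin> X" "reach A r x" using hit by blast
        show "\<exists>r\<in>R. reach A r x"
        proof (cases "r = b")
          case True
          then have "reach A w x" using rtrancl_trans[OF b(3)] r(3) by simp
          then show ?thesis by (auto simp: R_def)
        next
          case False
          then have "r \<in> R" using r by (auto simp: R_def X_def)
          then show ?thesis using r(3) by blast
        qed
      qed
      ultimately show False using main[of R] cE finite_nbrs by (auto simp: R_def)
    qed
  qed
qed

end

text \<open>An unbounded set whose connected proper subsets are all bounded would satisfy the locale
  assumptions, which are contradictory.\<close>

lemma connected_edges_bounded:
  assumes "finite E" "\<forall>e\<in>E. card e = 2" "connected_edges E"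
  shows "bounded E"
  using assms
proof (induction E rule: finite_psubset_induct)
  case (psubset E)
  show ?case
  proof (rule ccontr)
    assume "\<not> bounded E"
    with psubset have "minimal_counterexample E"
      by unfold_locales (auto dest: psubset_imp_subset)
    then show False by (rule minimal_counterexample.no_counterexample)
  qed
qed


section \<open>From coloured graphs to edge sets\<close>

lemma contains_matching_graphD:
  assumes "contains_copy (Graph V E) (matching_graph n)"
  shows "\<exists>N\<subseteq>E. matching N \<and> card N = n"
proof -
  obtain f where inj: "inj_on f {..<2 * n}"
    and f: "\<And>i. i < n \<Longrightarrow> f ` {2 * i, 2 * i + 1} \<in> E"
    using assms unfolding contains_copy_def matching_graph_def by auto
  define g where "g i = f ` {2 * i, 2 * i + 1}" for i
  have disj: "g i \<inter> g j = {}" if "i < n" "j < n" "i \<noteq> j" for i j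
  proof -
    have "g i \<inter> g j = f ` ({2 * i, 2 * i + 1} \<inter> {2 * j, 2 * j + 1})"
      unfolding g_def using that by (intro inj_on_image_Int[OF inj, symmetric]) auto
    also have "{2 * i, 2 * i + 1} \<inter> {2 * j, 2 * j + 1} = {}" using that(3) by auto
    finally show ?thesis by simp
  qed
  have "g i \<noteq> {}" for i unfolding g_def by simp
  then have "inj_on g {..<n}" using disj by (metis inf.idem inj_onI lessThan_iff)
  then have "card (g ` {..<n}) = n" by (simp add: card_image)
  moreover have "g ` {..<n} \<subseteq> E" using f unfolding g_def by auto
  moreover have "matching (g ` {..<n})" unfolding matching_def using disj by fastforce
  ultimately show ?thesis by blast
qed

text \<open>Two distinct edges through a common vertex have different other ends and so form a path.
  This turns the absence of a blue \<open>P\<^sub>3\<close> into a condition on edge sets.\<close>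

lemma contains_path_graph_3_iff:
  assumes "E \<subseteq> [V]\<^bsup>2\<^esup>"
  shows "contains_copy (Graph V E) (path_graph 3) \<longleftrightarrow> \<not> matching E"
proof
  have path: "edges (path_graph 3) = {{0, 1}, {1, 2}}"
  proof -
    have "i + 1 < 3 \<longleftrightarrow> i = 0 \<or> i = 1" for i :: nat by auto
    then show ?thesis unfolding path_graph_def by (auto simp: numeral_2_eq_2)
  qed
  {
    assume "contains_copy (Graph V E) (path_graph 3)"
    then obtain f :: "nat \<Rightarrow> 'a" where inj: "inj_on f {..<3}"
      and f: "\<forall>e\<in>edges (path_graph 3). f ` e \<in> E"
      unfolding contains_copy_def by (auto simp: path_graph_def)
    have "f 0 \<noteq> f 2" "f 0 \<noteq> f 1" "f 1 \<noteq> f 2" using inj_onD[OF inj] by fastforce+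
    then have "{f 0, f 1} \<noteq> {f 1, f 2}" by (auto simp: doubleton_eq_iff)
    moreover have "{f 0, f 1} \<in> E" "{f 1, f 2} \<in> E" using f unfolding path by auto
    moreover have "{f 0, f 1} \<inter> {f 1, f 2} \<noteq> {}" by simp
    ultimately show "\<not> matching E" unfolding matching_def by meson
  next
    assume "\<not> matching E"
    then obtain d e x where de: "d \<in> E" "e \<in> E" "d \<noteq> e" "x \<in> d" "x \<in> e"
      unfolding matching_def by blast
    then have "d \<subseteq> V" "e \<subseteq> V" "card d = 2" "card e = 2" using assms by (auto simp: nsets_def)
    then obtain u w where uw: "d = {u, x}" "e = {x, w}" "u \<noteq> x" "w \<noteq> x"
      using de(4,5) by (auto simp: card_2_iff)
    define f :: "nat \<Rightarrow> 'a" where "f i = (if i = 0 then u else if i = 1 then x else w)" for i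
    have "inj_on f {..<3}" using uw de(3) by (auto simp: inj_on_def f_def)
    moreover have "f ` {..<3} \<subseteq> V" using uw \<open>d \<subseteq> V\<close> \<open>e \<subseteq> V\<close> by (auto simp: f_def)
    moreover have "\<forall>e\<in>edges (path_graph 3). f ` e \<in> E" using uw de(1,2) by (simp add: path f_def insert_commute)
    ultimately show "contains_copy (Graph V E) (path_graph 3)"
      unfolding contains_copy_def by (auto simp: path_graph_def)
  }
qed

text \<open>Colour the matching \<open>M\<close> supplied by \<open>bounded\<close> blue and the
  rest red. Blue has no \<open>P\<^sub>3\<close>, so there are \<open>n\<close> disjoint red edges,
  whence \<open>n \<le> t\<close>.\<close>

lemma arrows_imp_card_edges:
  assumes "simple_graph G" "connected_graph G" "arrows G (matching_graph n) (path_graph 3)"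
  shows "5 * n \<le> 2 * (card (edges G) + 1)"
proof -
  let ?E = "edges G"
  have sub: "?E \<subseteq> [verts G]\<^bsup>2\<^esup>" and "finite (verts G)"
    using assms(1) unfolding simple_graph_def by auto
  then have "finite ?E" by (meson finite_imp_finite_nsets finite_subset)
  moreover have "\<forall>e\<in>?E. card e = 2" using sub by (auto simp: nsets_def)
  moreover have "\<Union>?E \<subseteq> verts G" using sub by (auto simp: nsets_def)
  then have "connected_edges ?E"
    using assms(2) unfolding connected_edges_def connected_graph_def by blast
  ultimately have "bounded ?E" by (rule connected_edges_bounded)
  then obtain t M where t: "5 * t \<le> 2 * (card ?E + 1)" and M: "M \<subseteq> ?E" "matching M"
    "\<And>N. N \<subseteq> ?E - M \<Longrightarrow> matching N \<Longrightarrow> card N \<le> t"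
    unfolding bounded_def residual_matching_le_def by blast
  define c where "c e = (if e \<in> M then Blue else Red)" for e
  have red: "{e \<in> ?E. c e = Red} = ?E - M" and blue: "{e \<in> ?E. c e = Blue} = M"
    using M(1) by (auto simp: c_def)
  have "\<not> contains_copy (colour_subgraph G c Blue) (path_graph 3)"
    unfolding colour_subgraph_def blue
    using contains_path_graph_3_iff[OF subset_trans[OF M(1) sub]] M(2) by simp
  then have "contains_copy (colour_subgraph G c Red) (matching_graph n)"
    using assms(3) unfolding arrows_def by blast
  then have "contains_copy (Graph (verts G) (?E - M)) (matching_graph n)"
    unfolding colour_subgraph_def red .
  then obtain N where "N \<subseteq> ?E - M" "matching N" "card N = n"
    using contains_matching_graphD[of "verts G"] by blast
  then have "n \<le> t" using M(3)[of N] by simp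
  then show ?thesis using t by linarith
qed

section \<open>The upper bound\<close>

text \<open>Four vertices for each of the \<open>n div 2\<close> cycles, and three for the final
  path if \<open>n\<close> is odd.\<close>

definition cycle_chain_order :: "nat \<Rightarrow> nat" where
  "cycle_chain_order n = 2 * n + n mod 2"

text \<open>A path through all vertices with chords: each chord closes one block of four consecutive
  vertices to a 4-cycle, and the path edges between blocks connect them.\<close>

definition cycle_chain :: "nat \<Rightarrow> nat graph" where
  "cycle_chain n = Graph {..<cycle_chain_order n}
     ((\<lambda>i. {i, i + 1}) ` {..<cycle_chain_order n - 1} \<union> (\<lambda>i. {4 * i, 4 * i + 3}) ` {..<n div 2})"

lemma chord_less: "i < n div 2 \<Longrightarrow> 4 * i + 3 < cycle_chain_order n"
  unfolding cycle_chain_order_def using div_times_less_eq_dividend[of n 2] by linarith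

lemma simple_graph_cycle_chain: "simple_graph (cycle_chain n)"
  unfolding simple_graph_def
proof
  show "finite (verts (cycle_chain n))" by (simp add: cycle_chain_def)
  show "edges (cycle_chain n) \<subseteq> [verts (cycle_chain n)]\<^bsup>2\<^esup>"
  proof
    fix e assume "e \<in> edges (cycle_chain n)"
    then consider i where "e = {i, i + 1}" "i < cycle_chain_order n - 1"
      | i where "e = {4 * i, 4 * i + 3}" "i < n div 2"
      by (auto simp: cycle_chain_def)
    then show "e \<in> [verts (cycle_chain n)]\<^bsup>2\<^esup>"
    proof cases
      case 1
      then show ?thesis by (auto simp: cycle_chain_def nsets_def)
    next
      case 2
      then show ?thesis using chord_less[OF 2(2)] by (auto simp: cycle_chain_def nsets_def)
    qed
  qed
qed

lemma connected_graph_cycle_chain: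
  assumes "n \<ge> 1"
  shows "connected_graph (cycle_chain n)"
proof -
  have "reach (edges (cycle_chain n)) 0 v" if "v < cycle_chain_order n" for v
    using that
  proof (induction v)
    case (Suc v)
    then have "{v, Suc v} \<in> edges (cycle_chain n)" by (force simp: cycle_chain_def)
    with Suc show ?case by (auto intro: reach_step)
  qed simp
  moreover have "0 \<in> verts (cycle_chain n)" using assms by (simp add: cycle_chain_def cycle_chain_order_def)
  moreover have "verts (cycle_chain n) = {..<cycle_chain_order n}" by (simp add: cycle_chain_def)
  ultimately show ?thesis
    unfolding connected_graph_def using reach_from_common[of 0 _ "edges (cycle_chain n)"] by auto
qed

lemma card_edges_cycle_chain: "card (edges (cycle_chain n)) \<le> (cycle_chain_order n - 1) + n div 2"
  unfolding cycle_chain_def graph.sel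
  by (rule order_trans[OF card_Un_le], rule add_mono; rule order_trans[OF card_image_le]) simp_all

lemma arrows_cycle_chain:
  "arrows (cycle_chain n) (matching_graph n) (path_graph 3)"
  unfolding arrows_def
proof
  fix c
  let ?E = "edges (cycle_chain n)"
  let ?blue = "{e \<in> ?E. c e = Blue}"
  have sub: "?E \<subseteq> [verts (cycle_chain n)]\<^bsup>2\<^esup>" 
    using simple_graph_cycle_chain[of n] unfolding simple_graph_def by simp
  have vs: "verts (cycle_chain n) = {..<cycle_chain_order n}" by (simp add: cycle_chain_def)
  show "contains_copy (colour_subgraph (cycle_chain n) c Red) (matching_graph n) \<or>
        contains_copy (colour_subgraph (cycle_chain n) c Blue) (path_graph 3)"
  proof (cases "matching ?blue")
    case False
    moreover have "?blue \<subseteq> [verts (cycle_chain n)]\<^bsup>2\<^esup>" using sub by blast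
    ultimately show ?thesis
      unfolding colour_subgraph_def using contains_path_graph_3_iff[of ?blue] by simp
  next
    case True
    have red: "c d = Red \<or> c e = Red" if "d \<in> ?E" "e \<in> ?E" "d \<noteq> e" "d \<inter> e \<noteq> {}" for d e
      using True that colour.exhaust unfolding matching_def by blast
    have path: "{i, i + 1} \<in> ?E" if "i + 1 < cycle_chain_order n" for i
      using that by (force simp: cycle_chain_def)
    have chord: "{4 * i, 4 * i + 3} \<in> ?E" if "i < n div 2" for i
      using that by (auto simp: cycle_chain_def)
    define ok where "ok i \<longleftrightarrow> c {4 * i, 4 * i + 1} = Red \<and>
      (i < n div 2 \<longrightarrow> c {4 * i + 2, 4 * i + 3} = Red)" for i
    \<comment> \<open>\<open>f\<close> keeps a block whose edges \<open>01\<close> and \<open>23\<close> are red and otherwise moves them to \<open>12\<close> and \<open>03\<close>.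
      In the final path of length two only \<open>01\<close> is present.\<close>
    define \<sigma> :: "nat \<Rightarrow> nat" where
      "\<sigma> r = (if r = 0 then 1 else if r = 1 then 2 else if r = 2 then 0 else 3)" for r
    define f where "f j = (if ok (j div 4) then j else 4 * (j div 4) + \<sigma> (j mod 4))" for j
    have \<sigma>_less: "r < 4 \<Longrightarrow> \<sigma> r < 4" for r by (auto simp: \<sigma>_def)
    have \<sigma>_inj: "r < 4 \<Longrightarrow> s < 4 \<Longrightarrow> \<sigma> r = \<sigma> s \<Longrightarrow> r = s" for r s
      by (auto simp: \<sigma>_def split: if_splits)
    have f_div: "f j div 4 = j div 4" for j
      using \<sigma>_less[of "j mod 4"] by (simp add: f_def)
    have f_mod: "f j mod 4 = (if ok (j div 4) then j mod 4 else \<sigma> (j mod 4))" for j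
      using \<sigma>_less[of "j mod 4"] by (simp add: f_def)
    have f_at: "f (4 * i + r) = (if ok i then 4 * i + r else 4 * i + \<sigma> r)" if "r < 4" for i r
      using that by (simp add: f_def)
    have "inj f"
    proof (rule injI)
      fix j k assume eq: "f j = f k"
      then have d: "j div 4 = k div 4" using f_div by metis
      then have "j mod 4 = k mod 4"
        using f_mod[of j] f_mod[of k] eq \<sigma>_inj by (auto split: if_splits)
      with d show "j = k" by (metis div_mult_mod_eq)
    qed
    then have "inj_on f {..<2 * n}" by (rule inj_on_subset) simp
    \<comment> \<open>\<open>f\<close> respects blocks, but the final path has only three vertices.
      There \<open>j mod 4\<close> is 0 or 1, since \<open>2 * n = 4 * (n div 2) + 2\<close> for odd
      \<open>n\<close>, and \<open>\<sigma>\<close> sends these to 1 and 2.\<close>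
    moreover have "f j < cycle_chain_order n" if "j < 2 * n" for j
    proof (cases "j div 4 < n div 2")
      case True
      have "f j < 4 * (j div 4) + 4" using f_div[of j] by linarith
      then show ?thesis using chord_less[OF True] by linarith
    next
      case False
      have j: "j = 4 * (j div 4) + j mod 4" and n: "n = 2 * (n div 2) + n mod 2" by simp_all
      have "n mod 2 \<noteq> 0" using that j n False by linarith
      then have n': "n = 2 * (n div 2) + 1" by presburger
      then have "j div 4 = n div 2" "j mod 4 < 2" using that j False by linarith+
      moreover have "j mod 4 < 2 \<Longrightarrow> \<sigma> (j mod 4) < 3" by (auto simp: \<sigma>_def)
      moreover have "cycle_chain_order n = 4 * (n div 2) + 3"
        using n' unfolding cycle_chain_order_def by presburger
      ultimately show ?thesis
        using that n' unfolding f_def by auto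
    qed
    moreover have "f ` {2 * j, 2 * j + 1} \<in> {e \<in> ?E. c e = Red}" if "j < n" for j
    proof -
      \<comment> \<open>\<open>i\<close> is the block of the pair; even \<open>j\<close> gives its
        edge \<open>01\<close>, odd \<open>j\<close> its edge \<open>23\<close>.\<close>
      define i where "i = j div 2"
      have "j = 2 * i \<or> j = 2 * i + 1" unfolding i_def by presburger
      then consider "j = 2 * i" | "j = 2 * i + 1" by blast
      then show ?thesis
      proof cases
        case 1
        have le: "4 * i + 2 < cycle_chain_order n"
          using 1 that unfolding cycle_chain_order_def by (cases "even n") (auto elim!: evenE oddE)
        have E: "{4 * i, 4 * i + 1} \<in> ?E" "{4 * i + 1, 4 * i + 2} \<in> ?E"
          using path[of "4 * i"] path[of "4 * i + 1"] le by (auto simp: numeral_2_eq_2)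
        have F: "f ` {2 * j, 2 * j + 1} = (if ok i then {4 * i, 4 * i + 1} else {4 * i + 1, 4 * i + 2})"
          using f_at[of 0 i] f_at[of 1 i] 1 by (simp add: \<sigma>_def)
        \<comment> \<open>If \<open>01\<close> is blue, then \<open>12\<close> meets it and is red.
          If \<open>01\<close> is red, then \<open>23\<close> is present and blue, and
          \<open>12\<close> meets that one.\<close>
        have "c {4 * i + 1, 4 * i + 2} = Red" if nok: "\<not> ok i"
        proof (cases "c {4 * i, 4 * i + 1} = Red")
          case False
          then show ?thesis using red[OF E] by (auto simp: doubleton_eq_iff)
        next
          case True
          then have "i < n div 2" "c {4 * i + 2, 4 * i + 3} \<noteq> Red" using nok by (auto simp: ok_def)
          moreover have "{4 * i + 2, 4 * i + 3} \<in> ?E"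
            using path[of "4 * i + 2"] chord_less calculation(1) by (auto simp: numeral_3_eq_3)
          ultimately show ?thesis
            using red[OF E(2), of "{4 * i + 2, 4 * i + 3}"] by (auto simp: doubleton_eq_iff)
        qed
        then show ?thesis using E F ok_def by auto
      next
        case 2
        then have i: "i < n div 2" using that by presburger
        have E: "{4 * i, 4 * i + 1} \<in> ?E" "{4 * i + 2, 4 * i + 3} \<in> ?E" "{4 * i, 4 * i + 3} \<in> ?E"
          using path[of "4 * i"] path[of "4 * i + 2"] chord[OF i] chord_less[OF i]
          by (auto simp: numeral_3_eq_3)
        have F: "f ` {2 * j, 2 * j + 1} = (if ok i then {4 * i + 2, 4 * i + 3} else {4 * i, 4 * i + 3})"
          using f_at[of 2 i] f_at[of 3 i] 2 by (simp add: \<sigma>_def numeral_3_eq_3)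
        \<comment> \<open>One of \<open>01\<close> and \<open>23\<close> is blue, and
          \<open>03\<close> meets both.\<close>
        have "c {4 * i, 4 * i + 3} = Red" if "\<not> ok i"
          using that red[OF E(1) E(3)] red[OF E(2) E(3)] i by (auto simp: ok_def doubleton_eq_iff)
        then show ?thesis using E F ok_def i by auto
      qed
    qed
    ultimately have "contains_copy (colour_subgraph (cycle_chain n) c Red) (matching_graph n)"
      unfolding contains_copy_def colour_subgraph_def matching_graph_def
      by (intro exI[of _ f]) (auto simp: vs)
    then show ?thesis ..
  qed
qed

section \<open>The two bounds combined\<close>

theorem theorem2:
  fixes n :: nat
  assumes "n \<ge> 1"
  shows "connected_size_ramsey (matching_graph n) (path_graph 3) =
           enat (nat \<lfloor>(5 * real n - 1) / 2\<rfloor>)"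
proof -
  have "\<lfloor>(5 * real n - 1) / 2\<rfloor> = \<lfloor>real_of_int (5 * int n - 1) / real_of_int 2\<rfloor>" by simp
  also have "\<dots> = (5 * int n - 1) div 2" by (rule floor_divide_of_int_eq)
  finally have val: "nat \<lfloor>(5 * real n - 1) / 2\<rfloor> = (5 * n - 1) div 2"
    using assms by (simp add: nat_div_distrib nat_diff_distrib nat_mult_distrib)
  show ?thesis
    unfolding val connected_size_ramsey_def
  proof (rule antisym)
    have "card (edges (cycle_chain n)) \<le> (5 * n - 1) div 2"
    proof -
      \<comment> \<open>Both sides are \<open>5 * k - 1\<close> for \<open>n = 2 * k\<close> and
        \<open>5 * k + 2\<close> for \<open>n = 2 * k + 1\<close>.\<close>
      have "(cycle_chain_order n - 1) + n div 2 = (5 * n - 1) div 2"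
        using assms unfolding cycle_chain_order_def
        by (cases "even n") (auto elim!: evenE oddE)
      then show ?thesis using card_edges_cycle_chain[of n] by simp
    qed
    then show "(INF G\<in>{G :: nat graph. simple_graph G \<and> connected_graph G \<and>
        arrows G (matching_graph n) (path_graph 3)}. enat (card (edges G))) \<le> enat ((5 * n - 1) div 2)"
      using simple_graph_cycle_chain connected_graph_cycle_chain[OF assms] arrows_cycle_chain
      by (intro INF_lower2[of "cycle_chain n"]) auto
  next
    show "enat ((5 * n - 1) div 2) \<le> (INF G\<in>{G :: nat graph. simple_graph G \<and> connected_graph G \<and>
        arrows G (matching_graph n) (path_graph 3)}. enat (card (edges G)))"
    proof (rule INF_greatest)
      fix G :: "nat graph"
      assume "G \<in> {G. simple_graph G \<and> connected_graph G \<and> arrows G (matching_graph n) (path_graph 3)}"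
      then have "5 * n \<le> 2 * (card (edges G) + 1)" using arrows_imp_card_edges by blast
      \<comment> \<open>For \<open>m\<close> edges, \<open>5 * n - 1 \<le> 2 * m + 1\<close>, and
        halving rounds the right side down to \<open>m\<close>.\<close>
      then show "enat ((5 * n - 1) div 2) \<le> enat (card (edges G))" by simp
    qed
  qed
qed

end
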